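(* Let $p\ge 1$, $0<\alpha<2$, let $(X,Y)$ be a pair of $\mathbb{R}^p$-valued random vectors, and let $(X_1,Y_1),\dots,(X_4,Y_4)$ be independent copies of $(X,Y)$. If $E|X|^{\alpha}+E|Y|^{\alpha}<\infty$, then $$\mathrm{siCov}^{(\alpha)}(X,Y)=2E|X_1+Y_1-X_2-Y_3|^{\alpha}-E|X_1+Y_2-X_3-Y_4|^{\alpha}-E|X_1+Y_1-X_2-Y_2|^{\alpha},$$ $$\mathrm{siCov}^{(\alpha)}(X)=2E|2X_1-X_2-X_3|^{\alpha}-E|X_1+X_2-X_3-X_4|^{\alpha}-2E|X_1-X_2|^{\alpha},$$ and $$\mathrm{siCov}^{(\alpha)}(Y)=2E|2Y_1-Y_2-Y_3|^{\alpha}-E|Y_1+Y_2-Y_3-Y_4|^{\alpha}-2E|Y_1-Y_2|^{\alpha}.$$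
   Context: $|\cdot|$ denotes the Euclidean norm on $\mathbb{R}^p$ (and the modulus for complex numbers), and $\langle\cdot,\cdot\rangle$ the Euclidean scalar product. For random vectors $X,Y\in\mathbb{R}^p$ let $\phi_{X,Y}(s,t)=E\,e^{i\langle s,X\rangle+i\langle t,Y\rangle}$, $\phi_X(t)=E\,e^{i\langle t,X\rangle}$, $\phi_Y(t)=E\,e^{i\langle t,Y\rangle}$. For $0<\alpha<2$, the $\alpha$-sub-independent covariance is $$\mathrm{siCov}^{(\alpha)}(X,Y)=\int_{\mathbb{R}^p}\bigl|\phi_{X,Y}(t,t)-\phi_X(t)\phi_Y(t)\bigr|^2\rho_\alpha(t)\,dt,\qquad \rho_\alpha(t)=\frac{1}{c(p,\alpha)\,|t|^{\alpha+p}},$$ $$c(p,\alpha)=\frac{2\pi^{p/2}\Gamma(1-\alpha/2)}{\alpha\,2^{\alpha}\,\Gamma((\alpha+p)/2)},$$ and $\mathrm{siCov}^{(\alpha)}(X)=\mathrm{siCov}^{(\alpha)}(X,X)$, $\mathrm{siCov}^{(\alpha)}(Y)=\mathrm{siCov}^{(\alpha)}(Y,Y)$.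
   Formalization: In the second and third formulas the last coefficient 2 is corrected to 2^α; the printed formulas fail for α≠1, e.g. for p=1 and X=±1 with probability 1/2 each, and agree with the corrected ones at α=1. *)

theory Defs
  imports "HOL-Probability.Probability"
begin

definition joint_char_fun ::
  "'a measure \<Rightarrow> ('a \<Rightarrow> 'v::euclidean_space) \<Rightarrow> ('a \<Rightarrow> 'v) \<Rightarrow> 'v \<Rightarrow> 'v \<Rightarrow> complex" where
  "joint_char_fun M X Y s t = (LINT \<omega>|M. iexp (s \<bullet> X \<omega> + t \<bullet> Y \<omega>))"

definition char_fun :: "'a measure \<Rightarrow> ('a \<Rightarrow> 'v::euclidean_space) \<Rightarrow> 'v \<Rightarrow> complex" where
  "char_fun M X t = (LINT \<omega>|M. iexp (t \<bullet> X \<omega>))"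

definition c_const :: "nat \<Rightarrow> real \<Rightarrow> real" where
  "c_const p \<alpha> = 2 * pi powr (real p / 2) * Gamma (1 - \<alpha> / 2) /
     (\<alpha> * 2 powr \<alpha> * Gamma ((\<alpha> + real p) / 2))"

text \<open>At the origin the division convention gives the density the value 0; a single point is
  Lebesgue-null, so this does not affect the integral below.\<close>

definition rho :: "real \<Rightarrow> real ^ 'p \<Rightarrow> real" where
  "rho \<alpha> t = 1 / (c_const CARD('p) \<alpha> * norm t powr (\<alpha> + real CARD('p)))"

text \<open>The integrand is nonnegative, so the integral is taken with values in $[0,\infty]$;
  an equation between \<open>siCov\<close> and a real number therefore includes its finiteness.
  The two one-vector quantities are \<open>siCov \<alpha> M X X\<close> and \<open>siCov \<alpha> M Y Y\<close>. As
  $|2 X_1 - 2 X_2|^\alpha = 2^\alpha |X_1 - X_2|^\alpha$, their last term carries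
  the factor $2^\alpha$, which is 2 only for $\alpha = 1$.\<close>

definition siCov :: "real \<Rightarrow> 'a measure \<Rightarrow> ('a \<Rightarrow> real ^ 'p) \<Rightarrow> ('a \<Rightarrow> real ^ 'p) \<Rightarrow> ennreal" where
  "siCov \<alpha> M X Y =
     (\<integral>\<^sup>+ t. ennreal ((cmod (joint_char_fun M X Y t t - char_fun M X t * char_fun M Y t))\<^sup>2 * rho \<alpha> t)
        \<partial>lborel)"

end

theory Submission
  imports Defs
begin

text \<open>The weight \<open>rho\<close> is normalised so that \<open>1 - cos (t \<bullet> z)\<close> integrates against it to \<open>|z|\<^sup>\<alpha>\<close>:
  write \<open>|t|\<close> to the power \<open>-(\<alpha> + p)\<close> as a Gamma-type mixture of Gaussians \<open>exp (- s |t|\<^sup>2)\<close>, use the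
  Fourier transform of the Gaussian and integrate over \<open>s\<close>; all integrands are nonnegative, so Tonelli
  applies. Consequently \<open>1 - Re \<phi>\<close>, for \<open>\<phi>\<close> the characteristic function of \<open>Z\<close>, integrates to
  \<open>E |Z|\<^sup>\<alpha>\<close>. By independence the three terms of
  \<open>|\<phi> - \<psi>|\<^sup>2 = Re (\<phi> \<phi>*) + Re (\<psi> \<psi>*) - 2 Re (\<phi> \<psi>*)\<close>, with \<open>\<phi> = \<phi>\<^sub>X\<^sub>,\<^sub>Y(t, t)\<close> and
  \<open>\<psi> = \<phi>\<^sub>X(t) \<phi>\<^sub>Y(t)\<close>, are real parts of characteristic functions of \<open>X\<^sub>1 + Y\<^sub>1 - X\<^sub>2 - Y\<^sub>2\<close>,
  \<open>X\<^sub>1 + Y\<^sub>2 - X\<^sub>3 - Y\<^sub>4\<close> and \<open>X\<^sub>1 + Y\<^sub>1 - X\<^sub>2 - Y\<^sub>3\<close>.\<close>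


section \<open>Gamma-type integrals over the half-line\<close>

text \<open>Euler's integral for \<open>Gamma b\<close> after the substitution s -> a s. With a =
  |t|^2 it turns a negative power of |t| into a mixture of Gaussians.\<close>

lemma nn_integral_powr_times_exp:
  fixes a b :: real
  assumes "a > 0" "b > 0"
  shows "(\<integral>\<^sup>+s. ennreal (s powr (b - 1) * exp (- (a * s))) * indicator {0<..} s \<partial>lborel)
    = ennreal (Gamma b / a powr b)"
proof -
  have "ennreal (Gamma b) = (\<integral>\<^sup>+s. ennreal (indicator {0..} s * s powr (b - 1) / exp s) \<partial>lborel)"
    using Gamma_conv_nn_integral_real[OF assms(2)] by simp
  also have "\<dots> = ennreal \<bar>a\<bar> *
      (\<integral>\<^sup>+s. ennreal (indicator {0..} (0 + a * s) * (0 + a * s) powr (b - 1) / exp (0 + a * s)) \<partial>lborel)"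
    by (rule nn_integral_real_affine) (use assms in auto)
  also have "\<dots> = (\<integral>\<^sup>+s. ennreal \<bar>a\<bar> *
      ennreal (indicator {0..} (0 + a * s) * (0 + a * s) powr (b - 1) / exp (0 + a * s)) \<partial>lborel)"
    by (rule nn_integral_cmult[symmetric]) auto
  also have "\<dots> = (\<integral>\<^sup>+s. ennreal (a powr b) *
      (ennreal (s powr (b - 1) * exp (- (a * s))) * indicator {0<..} s) \<partial>lborel)"
    using assms by (intro nn_integral_cong)
      (auto simp: indicator_def zero_le_mult_iff powr_mult ennreal_mult'[symmetric] exp_minus
        field_simps powr_diff)
  also have "\<dots> = ennreal (a powr b) *
      (\<integral>\<^sup>+s. ennreal (s powr (b - 1) * exp (- (a * s))) * indicator {0<..} s \<partial>lborel)"
    by (rule nn_integral_cmult) auto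
  finally have eq: "ennreal (a powr b) *
      (\<integral>\<^sup>+s. ennreal (s powr (b - 1) * exp (- (a * s))) * indicator {0<..} s \<partial>lborel)
      = ennreal (Gamma b)" ..
  have "(\<integral>\<^sup>+s. ennreal (s powr (b - 1) * exp (- (a * s))) * indicator {0<..} s \<partial>lborel)
     = ennreal (1 / a powr b) * (ennreal (a powr b) *
      (\<integral>\<^sup>+s. ennreal (s powr (b - 1) * exp (- (a * s))) * indicator {0<..} s \<partial>lborel))"
    using assms by (subst mult.assoc[symmetric], subst ennreal_mult'[symmetric]) auto
  also have "\<dots> = ennreal (Gamma b / a powr b)"
    unfolding eq using assms by (subst ennreal_mult'[symmetric]) (auto simp: Gamma_real_pos less_imp_le)
  finally show ?thesis .
qed

lemma nn_integral_powr_Icc: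
  fixes b u :: real
  assumes "b > 0" "u \<ge> 0"
  shows "(\<integral>\<^sup>+s. ennreal (s powr (b - 1)) * indicator {0..u} s \<partial>lborel) = ennreal (u powr b / b)"
  by (rule nn_integral_has_integral_lebesgue')
    (use has_integral_powr_from_0[of "b - 1" u] assms in auto)

text \<open>Writing \<open>1 - exp (- a / s)\<close> as the integral of \<open>a exp (- a u)\<close> over \<open>0 \<le> u \<le> 1 / s\<close> and
  exchanging the integrals leaves a Gamma integral.\<close>

lemma nn_integral_powr_one_minus_exp:
  fixes a b :: real
  assumes "a \<ge> 0" "0 < b" "b < 1"
  shows "(\<integral>\<^sup>+s. ennreal (s powr (b - 1) * (1 - exp (- (a / s)))) * indicator {0<..} s \<partial>lborel)
    = ennreal (a powr b * Gamma (1 - b) / b)"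
proof (cases "a = 0")
  case False
  with assms have a: "a > 0" by simp
  have inner: "(\<integral>\<^sup>+u. ennreal (a * exp (- (a * u))) * indicator {0..1/s} u \<partial>lborel)
      = ennreal (1 - exp (- (a / s)))" if "s > 0" for s
    using a that
    by (subst nn_integral_FTC_Icc[where F = "\<lambda>u. - exp (- (a * u))"])
      (auto intro!: derivative_eq_intros)
  have "(\<integral>\<^sup>+s. ennreal (s powr (b - 1) * (1 - exp (- (a / s)))) * indicator {0<..} s \<partial>lborel)
     = (\<integral>\<^sup>+s. (\<integral>\<^sup>+u. ennreal (s powr (b - 1)) * indicator {0<..} s *
          (ennreal (a * exp (- (a * u))) * indicator {0..1/s} u) \<partial>lborel) \<partial>lborel)"
    by (intro nn_integral_cong, subst nn_integral_cmult)
      (auto simp: inner ennreal_mult' split: split_indicator)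
  also have "\<dots> = (\<integral>\<^sup>+u. (\<integral>\<^sup>+s. ennreal (s powr (b - 1)) * indicator {0<..} s *
          (ennreal (a * exp (- (a * u))) * indicator {0..1/s} u) \<partial>lborel) \<partial>lborel)"
    by (rule lborel_pair.Fubini') (simp add: indicator_def)
  also have "\<dots> = (\<integral>\<^sup>+u. ennreal (a / b) *
      (ennreal (u powr ((1 - b) - 1) * exp (- (a * u))) * indicator {0<..} u) \<partial>lborel)"
  proof (rule nn_integral_cong_AE)
    \<comment> \<open>At u = 0 the inner integral is that of a multiple of s powr (b - 1) over all s
      > 0, which diverges, while the right-hand side is 0.\<close>
    have "AE u in lborel. u \<noteq> (0::real)" by (rule AE_lborel_singleton)
    then show "AE u in lborel. (\<integral>\<^sup>+s. ennreal (s powr (b - 1)) * indicator {0<..} s *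
          (ennreal (a * exp (- (a * u))) * indicator {0..1/s} u) \<partial>lborel) = ennreal (a / b) *
      (ennreal (u powr ((1 - b) - 1) * exp (- (a * u))) * indicator {0<..} u)"
    proof eventually_elim
      case (elim u)
      show ?case
      proof (cases "u > 0")
        \<comment> \<open>For positive s and u, u \<le> 1/s means s \<le> 1/u. The endpoint s = 0
          may be included because \<open>0 powr x\<close> is 0.\<close>
        case True
        have "(\<integral>\<^sup>+s. ennreal (s powr (b - 1)) * indicator {0<..} s *
            (ennreal (a * exp (- (a * u))) * indicator {0..1/s} u) \<partial>lborel)
          = (\<integral>\<^sup>+s. ennreal (a * exp (- (a * u))) *
              (ennreal (s powr (b - 1)) * indicator {0..1/u} s) \<partial>lborel)"
          using True
          by (intro nn_integral_cong) (auto simp: indicator_def field_simps)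
        also have "\<dots> = ennreal (a * exp (- (a * u))) * ennreal ((1 / u) powr b / b)"
          using True assms by (subst nn_integral_cmult) (auto simp: nn_integral_powr_Icc)
        also have "\<dots> = ennreal (a / b) * (ennreal (u powr ((1 - b) - 1) * exp (- (a * u))))"
          using True assms a
          by (auto simp: ennreal_mult'[symmetric] powr_divide powr_minus field_simps)
        finally show ?thesis using True by simp
      next
        case False
        with elim have "u < 0" by simp
        then show ?thesis by (simp add: indicator_def)
      qed
    qed
  qed
  also have "\<dots> = ennreal (a / b) * ennreal (Gamma (1 - b) / a powr (1 - b))"
    using assms a by (subst nn_integral_cmult, simp, subst nn_integral_powr_times_exp) simp_all
  also have "\<dots> = ennreal (a powr b * Gamma (1 - b) / b)"
    using assms a by (subst ennreal_mult'[symmetric]) (auto simp: powr_diff field_simps)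
  finally show ?thesis .
qed (use assms in simp)

section \<open>Fourier transform of the Gaussian\<close>

text \<open>A rescaling of the characteristic function of the standard normal law. The complex form
  is kept because, unlike the cosine, it factors over coordinates.\<close>

lemma has_bochner_integral_Gaussian_iexp_real:
  fixes s z :: real
  assumes "s > 0"
  shows "has_bochner_integral lborel (\<lambda>x. of_real (exp (- (s * x\<^sup>2))) * iexp (x * z))
    (of_real (sqrt (pi / s) * exp (- (z\<^sup>2 / (4 * s)))))"
proof -
  \<comment> \<open>The substitution by \<open>?c\<close> turns the exponent x^2 / 2 into s x^2, and
    the frequency \<open>?w\<close> makes the phase x z afterwards.\<close>
  let ?c = "sqrt (2 * s)"
  let ?w = "z / ?c"
  have c: "?c > 0" "?c\<^sup>2 = 2 * s" using assms by auto
  have int: "integrable std_normal_distribution (\<lambda>x. iexp (?w * x))"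
    using prob_space.integrable_iexp[OF prob_space_normal_density, of 1 "\<lambda>x. of_real (?w * x)"] by simp
  then have "integrable lborel (\<lambda>x. std_normal_density x *\<^sub>R iexp (?w * x))"
    by (subst (asm) integrable_density) auto
  moreover have "(LINT x|lborel. std_normal_density x *\<^sub>R iexp (?w * x)) = of_real (exp (- (?w\<^sup>2) / 2))"
    using fun_cong[OF char_std_normal_distribution, of ?w]
    unfolding char_def by (subst (asm) integral_density) auto
  ultimately have "has_bochner_integral lborel (\<lambda>x. std_normal_density x *\<^sub>R iexp (?w * x))
     (of_real (exp (- (?w\<^sup>2) / 2)))"
    by (simp add: has_bochner_integral_iff)
  then have "has_bochner_integral lborel (\<lambda>x. std_normal_density (0 + ?c * x) *\<^sub>R iexp (?w * (0 + ?c * x)))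
     (of_real (exp (- (?w\<^sup>2) / 2)) /\<^sub>R \<bar>?c\<bar>)"
    by (subst (asm) lborel_has_bochner_integral_real_affine_iff[where c = ?c and t = 0]) (use c in simp_all)
  then have "has_bochner_integral lborel (\<lambda>x. of_real (sqrt (2 * pi)) *
        (std_normal_density (0 + ?c * x) *\<^sub>R iexp (?w * (0 + ?c * x))))
     (of_real (sqrt (2 * pi)) * (of_real (exp (- (?w\<^sup>2) / 2)) /\<^sub>R \<bar>?c\<bar>))"
    by (rule has_bochner_integral_mult_right)
  also have "(\<lambda>x. of_real (sqrt (2 * pi)) *
        (std_normal_density (0 + ?c * x) *\<^sub>R iexp (?w * (0 + ?c * x))))
      = (\<lambda>x. of_real (exp (- (s * x\<^sup>2))) * iexp (x * z))"
  proof
    fix x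
    have "sqrt (2 * pi) * std_normal_density (0 + ?c * x) = exp (- (s * x\<^sup>2))"
      using c by (simp add: std_normal_density_def power_mult_distrib)
    moreover have "?w * (0 + ?c * x) = x * z"
      using c by simp
    ultimately show "of_real (sqrt (2 * pi)) * (std_normal_density (0 + ?c * x) *\<^sub>R iexp (?w * (0 + ?c * x)))
        = of_real (exp (- (s * x\<^sup>2))) * iexp (x * z)"
      by (simp only: scaleR_conv_of_real mult.assoc[symmetric] of_real_mult[symmetric])
  qed
  also have "of_real (sqrt (2 * pi)) * (of_real (exp (- (?w\<^sup>2) / 2)) /\<^sub>R \<bar>?c\<bar>)
      = complex_of_real (sqrt (pi / s) * exp (- (z\<^sup>2 / (4 * s))))"
    using c assms by (auto simp: scaleR_conv_of_real power_divide real_sqrt_mult real_sqrt_divide field_simps)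
  finally show ?thesis .
qed

text \<open>\<open>lborel\<close> on a Euclidean space is the image of a product of one-dimensional
  Lebesgue measures, so the integral of a product of functions of single coordinates splits.\<close>

lemma has_bochner_integral_lborel_prod:
  fixes f :: "'v::euclidean_space \<Rightarrow> real \<Rightarrow> 'b::{real_normed_field,banach,second_countable_topology}"
  assumes "\<And>b. b \<in> Basis \<Longrightarrow> has_bochner_integral lborel (f b) (c b)"
  shows "has_bochner_integral lborel (\<lambda>x. \<Prod>b\<in>Basis. f b (x \<bullet> b)) (\<Prod>b\<in>Basis. c b)"
proof -
  interpret product_sigma_finite "\<lambda>_::'v. lborel :: real measure" ..
  have int: "integrable lborel (f b)" and eq: "integral\<^sup>L lborel (f b) = c b" if "b \<in> Basis" for b
    using assms[OF that] by (auto simp: has_bochner_integral_iff)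
  have [measurable]: "f b \<in> borel_measurable borel" if "b \<in> Basis" for b
    using int[OF that] by simp
  have [simp]: "(\<Prod>b\<in>Basis. f b ((\<Sum>i\<in>Basis. g i *\<^sub>R i) \<bullet> b)) = (\<Prod>b\<in>Basis. f b (g b))" for g
    by (intro prod.cong) auto
  show ?thesis
    unfolding has_bochner_integral_iff lborel_eq[where 'a='v]
    by (auto simp: integrable_distr_eq integral_distr int eq product_integral_prod
        intro!: product_integrable_prod)
qed

text \<open>The squared norm and the inner product are both sums over \<open>Basis\<close>, so the
  integrand is a product of one-dimensional ones.\<close>

lemma has_bochner_integral_Gaussian_iexp:
  fixes z :: "'v::euclidean_space"
  assumes "s > 0"
  shows "has_bochner_integral lborel (\<lambda>t. of_real (exp (- (s * (norm t)\<^sup>2))) * iexp (t \<bullet> z))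
    (of_real ((pi / s) powr (DIM('v) / 2) * exp (- ((norm z)\<^sup>2 / (4 * s)))))"
proof -
  have nrm: "(norm t)\<^sup>2 = (\<Sum>b\<in>Basis. (t \<bullet> b)\<^sup>2)" for t :: 'v
    by (simp add: norm_eq_sqrt_inner euclidean_inner[of t t] power2_eq_square inner_ge_zero sum_nonneg)
  have inn: "t \<bullet> z = (\<Sum>b\<in>Basis. (t \<bullet> b) * (z \<bullet> b))" for t
    by (rule euclidean_inner)
  have "has_bochner_integral lborel
      (\<lambda>t::'v. \<Prod>b\<in>Basis. of_real (exp (- (s * (t \<bullet> b)\<^sup>2))) * iexp ((t \<bullet> b) * (z \<bullet> b)))
      (\<Prod>b\<in>(Basis::'v set). of_real (sqrt (pi / s) * exp (- ((z \<bullet> b)\<^sup>2 / (4 * s)))))"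
    by (intro has_bochner_integral_lborel_prod has_bochner_integral_Gaussian_iexp_real assms)
  also have "(\<lambda>t::'v. \<Prod>b\<in>Basis. of_real (exp (- (s * (t \<bullet> b)\<^sup>2))) * iexp ((t \<bullet> b) * (z \<bullet> b)))
      = (\<lambda>t. of_real (exp (- (s * (norm t)\<^sup>2))) * iexp (t \<bullet> z))"
    unfolding nrm inn
    by (simp add: prod.distrib exp_sum[symmetric] sum_distrib_left sum_negf[symmetric] flip: of_real_prod)
  also have "(\<Prod>b\<in>(Basis::'v set). of_real (sqrt (pi / s) * exp (- ((z \<bullet> b)\<^sup>2 / (4 * s)))))
      = complex_of_real (sqrt (pi / s) ^ DIM('v) * exp (- ((norm z)\<^sup>2 / (4 * s))))"
    unfolding nrm
    by (simp add: prod.distrib exp_sum[symmetric] sum_divide_distrib sum_negf[symmetric] flip: of_real_prod)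
  also have "sqrt (pi / s) ^ DIM('v) = (pi / s) powr (DIM('v) / 2)"
    using assms by (simp add: powr_half_sqrt[symmetric] powr_realpow[symmetric] powr_powr)
  finally show ?thesis .
qed

section \<open>Normalisation of the weight\<close>

text \<open>Real part of the Gaussian transform at 0 minus that at \<open>z\<close>. The subtraction
  is done with Bochner integrals; nonnegativity then gives the form that Tonelli needs.\<close>

lemma nn_integral_one_minus_cos_Gaussian:
  fixes z :: "'v::euclidean_space"
  assumes "s > 0"
  shows "(\<integral>\<^sup>+t. ennreal ((1 - cos (t \<bullet> z)) * exp (- (s * (norm t)\<^sup>2))) \<partial>lborel)
    = ennreal ((pi / s) powr (DIM('v) / 2) * (1 - exp (- ((norm z)\<^sup>2 / (4 * s)))))"
proof -
  have g: "has_bochner_integral lborel (\<lambda>t. exp (- (s * (norm t)\<^sup>2)) * cos (t \<bullet> z))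
      ((pi / s) powr (DIM('v) / 2) * exp (- ((norm z)\<^sup>2 / (4 * s))))" for z :: 'v
    using has_bochner_integral_Re[OF has_bochner_integral_Gaussian_iexp[OF assms, of z]]
    by (simp add: cis_conv_exp[symmetric])
  have "has_bochner_integral lborel (\<lambda>t. (1 - cos (t \<bullet> z)) * exp (- (s * (norm t)\<^sup>2)))
     ((pi / s) powr (DIM('v) / 2) * (1 - exp (- ((norm z)\<^sup>2 / (4 * s)))))"
    using has_bochner_integral_diff[OF g[of 0] g[of z]] by (simp add: algebra_simps)
  then show ?thesis
    by (subst nn_integral_eq_integral) (auto simp: has_bochner_integral_iff)
qed

text \<open>\<open>c_const\<close> collects \<open>1 / Gamma \<beta>\<close> from the mixture, a
  power of pi from the Gaussian and a Gamma factor from the integral over s. The latter uses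
  exponent b = \<alpha> / 2, for which 0 < b < 1 is the condition 0 < \<alpha> < 2.\<close>

lemma nn_integral_one_minus_cos_div_norm_powr:
  fixes z :: "'v::euclidean_space"
    and \<alpha> :: real
  assumes "0 < \<alpha>" "\<alpha> < 2"
  shows "(\<integral>\<^sup>+t. ennreal ((1 - cos (t \<bullet> z)) / norm t powr (\<alpha> + DIM('v))) \<partial>lborel)
    = ennreal (c_const DIM('v) \<alpha> * norm z powr \<alpha>)"
proof -
  \<comment> \<open>Half the exponent of |t|, since the Gaussian mixture produces powers of
    |t|^2.\<close>
  define \<beta> where "\<beta> = (\<alpha> + DIM('v)) / 2"
  have \<beta>: "\<beta> > 0" using assms by (simp add: \<beta>_def add_pos_nonneg)
  then have G: "Gamma \<beta> > 0" "Gamma \<beta> \<noteq> 0" using Gamma_real_pos[of \<beta>] by linarith+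
  have c: "1 - cos x \<ge> 0" for x :: real by simp
  have "(\<integral>\<^sup>+t. ennreal ((1 - cos (t \<bullet> z)) / norm t powr (\<alpha> + DIM('v))) \<partial>lborel)
    = (\<integral>\<^sup>+t. (\<integral>\<^sup>+s. ennreal (1 / Gamma \<beta>) * ennreal (1 - cos (t \<bullet> z)) *
        (ennreal (s powr (\<beta> - 1) * exp (- ((norm t)\<^sup>2 * s))) * indicator {0<..} s) \<partial>lborel) \<partial>lborel)"
  proof (intro nn_integral_cong)
    fix t :: 'v
    show "ennreal ((1 - cos (t \<bullet> z)) / norm t powr (\<alpha> + DIM('v))) =
       (\<integral>\<^sup>+s. ennreal (1 / Gamma \<beta>) * ennreal (1 - cos (t \<bullet> z)) *
        (ennreal (s powr (\<beta> - 1) * exp (- ((norm t)\<^sup>2 * s))) * indicator {0<..} s) \<partial>lborel)"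
    \<comment> \<open>At the origin both sides vanish because 1 - cos 0 = 0; the Gamma integral
      needs |t|^2 > 0.\<close>
    proof (cases "t = 0")
      case False
      then have "((norm t)\<^sup>2) powr \<beta> = norm t powr (\<alpha> + DIM('v))"
        by (simp add: \<beta>_def powr_powr add_divide_distrib flip: powr_numeral)
      then show ?thesis
        using False \<beta> G by (subst nn_integral_cmult)
          (auto simp: nn_integral_powr_times_exp c simp flip: ennreal_mult')
    qed simp
  qed
  also have "\<dots> = (\<integral>\<^sup>+s. (\<integral>\<^sup>+t. ennreal (1 / Gamma \<beta>) * ennreal (1 - cos (t \<bullet> z)) *
        (ennreal (s powr (\<beta> - 1) * exp (- ((norm t)\<^sup>2 * s))) * indicator {0<..} s) \<partial>lborel) \<partial>lborel)"
    by (rule lborel_pair.Fubini') simp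
  also have "\<dots> = (\<integral>\<^sup>+s. ennreal (pi powr (DIM('v) / 2) / Gamma \<beta>) *
     (ennreal (s powr (\<alpha> / 2 - 1) * (1 - exp (- (((norm z)\<^sup>2 / 4) / s)))) * indicator {0<..} s) \<partial>lborel)"
  proof (intro nn_integral_cong)
    fix s :: real
    show "(\<integral>\<^sup>+t. ennreal (1 / Gamma \<beta>) * ennreal (1 - cos (t \<bullet> z)) *
        (ennreal (s powr (\<beta> - 1) * exp (- ((norm t)\<^sup>2 * s))) * indicator {0<..} s) \<partial>lborel) =
     ennreal (pi powr (DIM('v) / 2) / Gamma \<beta>) *
     (ennreal (s powr (\<alpha> / 2 - 1) * (1 - exp (- (((norm z)\<^sup>2 / 4) / s)))) * indicator {0<..} s)"
    proof (cases "s > 0")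
      case True
      have "(\<integral>\<^sup>+t. ennreal (1 / Gamma \<beta>) * ennreal (1 - cos (t \<bullet> z)) *
        (ennreal (s powr (\<beta> - 1) * exp (- ((norm t)\<^sup>2 * s))) * indicator {0<..} s) \<partial>lborel)
        = (\<integral>\<^sup>+t. ennreal (s powr (\<beta> - 1) / Gamma \<beta>) *
            ennreal ((1 - cos (t \<bullet> z)) * exp (- (s * (norm t)\<^sup>2))) \<partial>lborel)"
        using True G by (intro nn_integral_cong) (simp add: c mult_ac flip: ennreal_mult')
      also have "\<dots> = ennreal (s powr (\<beta> - 1) / Gamma \<beta>) *
          ennreal ((pi / s) powr (DIM('v) / 2) * (1 - exp (- ((norm z)\<^sup>2 / (4 * s)))))"
        using True by (subst nn_integral_cmult) (auto simp: nn_integral_one_minus_cos_Gaussian)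
      \<comment> \<open>The Gaussian contributes s to the power -p/2, with p the dimension, lowering
        the exponent \<open>\<beta> - 1\<close> to \<open>\<alpha> / 2 - 1\<close>.\<close>
      also have "\<dots> = ennreal (pi powr (DIM('v) / 2) / Gamma \<beta> * (s powr (\<alpha> / 2 - 1) * (1 - exp (- (((norm z)\<^sup>2 / 4) / s)))))"
        using True G
        by (subst ennreal_mult'[symmetric])
          (auto simp: \<beta>_def powr_divide powr_diff powr_add add_divide_distrib mult_ac)
      also have "\<dots> = ennreal (pi powr (DIM('v) / 2) / Gamma \<beta>) *
          ennreal (s powr (\<alpha> / 2 - 1) * (1 - exp (- (((norm z)\<^sup>2 / 4) / s))))"
        using G by (intro ennreal_mult') simp
      finally show ?thesis using True by simp
    qed simp
  qed
  also have "\<dots> = ennreal (pi powr (DIM('v) / 2) / Gamma \<beta>) *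
      ennreal (((norm z)\<^sup>2 / 4) powr (\<alpha> / 2) * Gamma (1 - \<alpha> / 2) / (\<alpha> / 2))"
    using assms by (subst nn_integral_cmult, simp, subst nn_integral_powr_one_minus_exp) simp_all
  \<comment> \<open>The 4 of the Gaussian transform becomes the factor
    \<open>2 powr \<alpha>\<close> of \<open>c_const\<close>.\<close>
  also have "((norm z)\<^sup>2 / 4) powr (\<alpha> / 2) = norm z powr \<alpha> / 2 powr \<alpha>"
  proof -
    have "(norm z)\<^sup>2 / 4 = (norm z / 2) powr 2" by (simp add: power_divide)
    then show ?thesis by (simp add: powr_powr powr_divide del: powr_numeral)
  qed
  also have "ennreal (pi powr (DIM('v) / 2) / Gamma \<beta>) *
      ennreal (norm z powr \<alpha> / 2 powr \<alpha> * Gamma (1 - \<alpha> / 2) / (\<alpha> / 2))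
     = ennreal (c_const DIM('v) \<alpha> * norm z powr \<alpha>)"
    using G by (subst ennreal_mult'[symmetric]) (auto simp: c_const_def \<beta>_def mult_ac)
  finally show ?thesis .
qed

lemma c_const_pos: "0 < \<alpha> \<Longrightarrow> \<alpha> < 2 \<Longrightarrow> c_const p \<alpha> > 0"
  unfolding c_const_def by (intro divide_pos_pos mult_pos_pos Gamma_real_pos) auto

lemma borel_measurable_rho [measurable]: "rho \<alpha> \<in> borel_measurable borel"
  unfolding rho_def[abs_def] by measurable

lemma rho_nonneg: "0 < \<alpha> \<Longrightarrow> \<alpha> < 2 \<Longrightarrow> rho \<alpha> (t :: real ^ 'p) \<ge> 0"
  using c_const_pos[of \<alpha> "CARD('p)"] by (simp add: rho_def)

lemma nn_integral_one_minus_cos_rho: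
  fixes z :: "real ^ 'p"
  assumes "0 < \<alpha>" "\<alpha> < 2"
  shows "(\<integral>\<^sup>+t. ennreal ((1 - cos (t \<bullet> z)) * rho \<alpha> t) \<partial>lborel) = ennreal (norm z powr \<alpha>)"
proof -
  let ?c = "c_const CARD('p) \<alpha>"
  have c: "?c > 0" using assms by (rule c_const_pos)
  have "(\<integral>\<^sup>+t. ennreal ((1 - cos (t \<bullet> z)) * rho \<alpha> t) \<partial>lborel)
      = (\<integral>\<^sup>+t. ennreal (1 / ?c) * ennreal ((1 - cos (t \<bullet> z)) / norm t powr (\<alpha> + CARD('p))) \<partial>lborel)"
    using c by (intro nn_integral_cong) (auto simp: rho_def mult_ac simp flip: ennreal_mult')
  also have "\<dots> = ennreal (1 / ?c) * ennreal (?c * norm z powr \<alpha>)"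
    using nn_integral_one_minus_cos_div_norm_powr[OF assms, of z]
    by (subst nn_integral_cmult) auto
  also have "\<dots> = ennreal (norm z powr \<alpha>)"
    using c by (simp flip: ennreal_mult')
  finally show ?thesis .
qed

section \<open>Moments and characteristic functions of random vectors\<close>

text \<open>Bounding the norm of a sum by twice the larger norm gives the factor
  \<open>2 powr \<alpha>\<close> and treats exponents below and above 1 alike.\<close>

lemma integrable_norm_powr_add:
  fixes X Y :: "'a \<Rightarrow> 'v::euclidean_space"
  assumes [measurable]: "X \<in> borel_measurable M" "Y \<in> borel_measurable M"
    and "integrable M (\<lambda>\<omega>. norm (X \<omega>) powr \<alpha>)" "integrable M (\<lambda>\<omega>. norm (Y \<omega>) powr \<alpha>)" "\<alpha> \<ge> 0"
  shows "integrable M (\<lambda>\<omega>. norm (X \<omega> + Y \<omega>) powr \<alpha>)"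
proof (rule Bochner_Integration.integrable_bound)
  show "integrable M (\<lambda>\<omega>. 2 powr \<alpha> * (norm (X \<omega>) powr \<alpha> + norm (Y \<omega>) powr \<alpha>))"
    using assms by auto
  have "norm (x + y) powr \<alpha> \<le> 2 powr \<alpha> * (norm x powr \<alpha> + norm y powr \<alpha>)" for x y :: 'v
  proof -
    have "norm (x + y) \<le> 2 * max (norm x) (norm y)"
      using norm_triangle_ineq[of x y] by linarith
    then have "norm (x + y) powr \<alpha> \<le> 2 powr \<alpha> * max (norm x) (norm y) powr \<alpha>"
      using powr_mono2[OF \<open>\<alpha> \<ge> 0\<close> norm_ge_zero] by (metis powr_mult)
    also have "max (norm x) (norm y) powr \<alpha> \<le> norm x powr \<alpha> + norm y powr \<alpha>"
      by (simp add: max_def)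
    finally show ?thesis by simp
  qed
  then show "AE \<omega> in M. norm (norm (X \<omega> + Y \<omega>) powr \<alpha>)
      \<le> norm (2 powr \<alpha> * (norm (X \<omega>) powr \<alpha> + norm (Y \<omega>) powr \<alpha>))"
    by simp
qed measurable

lemma (in prob_space) integrable_iexp_inner:
  fixes Z :: "'a \<Rightarrow> 'v::euclidean_space"
  assumes [measurable]: "Z \<in> borel_measurable M"
  shows "integrable M (\<lambda>\<omega>. iexp (t \<bullet> Z \<omega>))"
  by (rule integrable_iexp) simp_all

text \<open>The integrand is the expectation of a nonnegative function of t and Z, so Tonelli
  reduces the claim to the normalisation of \<open>rho\<close>. Integrability is part of the
  conclusion because three such integrals are later combined with signs.\<close>

lemma (in prob_space) has_bochner_integral_one_minus_Re_char_fun_rho: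
  fixes Z :: "'a \<Rightarrow> real ^ 'p"
  assumes "0 < \<alpha>" "\<alpha> < 2" and [measurable]: "Z \<in> borel_measurable M"
    and int: "integrable M (\<lambda>\<omega>. norm (Z \<omega>) powr \<alpha>)"
  shows "has_bochner_integral lborel (\<lambda>t. (1 - Re (char_fun M Z t)) * rho \<alpha> t)
    (LINT \<omega>|M. norm (Z \<omega>) powr \<alpha>)"
proof -
  have int_cos: "integrable M (\<lambda>\<omega>. 1 - cos (t \<bullet> Z \<omega>))" for t
    by (rule integrable_const_bound[where B = 2]) (auto intro: order.trans[OF abs_triangle_ineq4] simp: abs_le_iff)
  have "Re (char_fun M Z t) = (LINT \<omega>|M. cos (t \<bullet> Z \<omega>))" for t
    unfolding char_fun_def integral_Re[OF integrable_iexp_inner[OF assms(3)], symmetric]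
    by (simp flip: cis_conv_exp)
  moreover have "integrable M (\<lambda>\<omega>. cos (t \<bullet> Z \<omega>))" for t
    by (rule integrable_const_bound[where B = 1]) auto
  ultimately have Re_eq: "1 - Re (char_fun M Z t) = (LINT \<omega>|M. 1 - cos (t \<bullet> Z \<omega>))" for t
    by (simp add: prob_space)
  have nonneg: "1 - Re (char_fun M Z t) \<ge> 0" for t
    unfolding Re_eq by (rule integral_nonneg_AE) simp
  interpret pair: pair_sigma_finite M "lborel :: (real ^ 'p) measure" ..
  have "(\<integral>\<^sup>+t. ennreal ((1 - Re (char_fun M Z t)) * rho \<alpha> t) \<partial>lborel)
      = (\<integral>\<^sup>+t. (\<integral>\<^sup>+\<omega>. ennreal ((1 - cos (t \<bullet> Z \<omega>)) * rho \<alpha> t) \<partial>M) \<partial>lborel)"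
    using assms int_cos
    by (intro nn_integral_cong, subst nn_integral_eq_integral) (auto simp: Re_eq rho_nonneg)
  also have "\<dots> = (\<integral>\<^sup>+\<omega>. (\<integral>\<^sup>+t. ennreal ((1 - cos (t \<bullet> Z \<omega>)) * rho \<alpha> t) \<partial>lborel) \<partial>M)"
    by (rule pair.Fubini') simp
  also have "\<dots> = ennreal (LINT \<omega>|M. norm (Z \<omega>) powr \<alpha>)"
    using int assms(1,2) by (simp add: nn_integral_one_minus_cos_rho nn_integral_eq_integral)
  finally have "(\<integral>\<^sup>+t. ennreal ((1 - Re (char_fun M Z t)) * rho \<alpha> t) \<partial>lborel)
      = ennreal (LINT \<omega>|M. norm (Z \<omega>) powr \<alpha>)" .
  then show ?thesis
    using assms(1,2) nonneg by (intro has_bochner_integral_nn_integral) (auto simp: rho_nonneg Re_eq)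
qed

text \<open>Only the pairs are independent; \<open>Xs i\<close> and \<open>Ys i\<close> may depend
  on each other, so each index contributes a joint characteristic function. The free coefficients
  cover all combinations needed later.\<close>

lemma (in prob_space) char_fun_sum_indep_copies:
  fixes Xs Ys :: "'i \<Rightarrow> 'a \<Rightarrow> 'v::euclidean_space"
  assumes "finite I" and [measurable]: "X \<in> borel_measurable P" "Y \<in> borel_measurable P"
    and indep: "indep_vars (\<lambda>_. borel) (\<lambda>i \<omega>. (Xs i \<omega>, Ys i \<omega>)) I"
    and distr_eq: "\<And>i. i \<in> I \<Longrightarrow> distr M borel (\<lambda>\<omega>. (Xs i \<omega>, Ys i \<omega>)) = distr P borel (\<lambda>\<omega>. (X \<omega>, Y \<omega>))"
  shows "char_fun M (\<lambda>\<omega>. \<Sum>i\<in>I. a i *\<^sub>R Xs i \<omega> + b i *\<^sub>R Ys i \<omega>) t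
    = (\<Prod>i\<in>I. joint_char_fun P X Y (a i *\<^sub>R t) (b i *\<^sub>R t))"
proof -
  \<comment> \<open>The exponential of the sum is the product of these functions, each evaluated at
    a single pair.\<close>
  define g where "g i = (\<lambda>(x, y). iexp ((a i *\<^sub>R t) \<bullet> x + (b i *\<^sub>R t) \<bullet> y))" for i
  have g [measurable]: "g i \<in> borel_measurable borel" for i
    unfolding g_def borel_prod[symmetric] by measurable
  have meas [measurable]: "(\<lambda>\<omega>. (Xs i \<omega>, Ys i \<omega>)) \<in> borel_measurable M" if "i \<in> I" for i
    using indep that by (auto simp: indep_vars_def)
  \<comment> \<open>The expectation depends only on the law of the pair, so it can be computed on
    the original space \<open>P\<close>.\<close>
  have gE: "(LINT \<omega>|M. g i (Xs i \<omega>, Ys i \<omega>)) = joint_char_fun P X Y (a i *\<^sub>R t) (b i *\<^sub>R t)"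
    if i: "i \<in> I" for i
  proof -
    have "(LINT \<omega>|M. g i (Xs i \<omega>, Ys i \<omega>)) = integral\<^sup>L (distr M borel (\<lambda>\<omega>. (Xs i \<omega>, Ys i \<omega>))) (g i)"
      using meas[OF i] by (simp add: integral_distr)
    also have "\<dots> = (LINT \<omega>|P. g i (X \<omega>, Y \<omega>))"
      unfolding distr_eq[OF i] by (rule integral_distr) auto
    finally show ?thesis by (simp add: joint_char_fun_def g_def)
  qed
  have "char_fun M (\<lambda>\<omega>. \<Sum>i\<in>I. a i *\<^sub>R Xs i \<omega> + b i *\<^sub>R Ys i \<omega>) t
      = (LINT \<omega>|M. (\<Prod>i\<in>I. g i (Xs i \<omega>, Ys i \<omega>)))"
    unfolding char_fun_def g_def using \<open>finite I\<close>
    by (simp add: exp_sum sum_distrib_left inner_sum_right inner_add_right)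
  also have "\<dots> = (\<Prod>i\<in>I. LINT \<omega>|M. g i (Xs i \<omega>, Ys i \<omega>))"
  proof (rule indep_vars_lebesgue_integral[OF \<open>finite I\<close>])
    show "indep_vars (\<lambda>_. borel) (\<lambda>i \<omega>. g i (Xs i \<omega>, Ys i \<omega>)) I"
      by (rule indep_vars_compose2[OF indep]) simp
    show "integrable M (\<lambda>\<omega>. g i (Xs i \<omega>, Ys i \<omega>))" if "i \<in> I" for i
      using measurable_compose[OF meas[OF that] g]
      by (intro integrable_const_bound[where B = 1]) (simp_all add: g_def del: of_real_add)
  qed
  finally show ?thesis using gE by simp
qed

section \<open>From the squared modulus to moments\<close>

text \<open>Written with \<open>cnj\<close> because conjugating a characteristic function negates
  its argument, so each product becomes a characteristic function of a combination of the
  copies.\<close>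

lemma cmod_diff_squared: "(cmod (z - w))\<^sup>2 = Re (z * cnj z) + Re (w * cnj w) - 2 * Re (z * cnj w)"
  unfolding cmod_power2 by (simp add: power2_eq_square algebra_simps)

lemma joint_char_fun_minus: "joint_char_fun M X Y (- s) (- t) = cnj (joint_char_fun M X Y s t)"
  unfolding joint_char_fun_def
  by (subst Bochner_Integration.integral_cnj[symmetric], rule Bochner_Integration.integral_cong) (simp_all add: exp_cnj algebra_simps)

lemma joint_char_fun_zero_right: "joint_char_fun M X Y s 0 = char_fun M X s"
  by (simp add: joint_char_fun_def char_fun_def)

lemma joint_char_fun_zero_left: "joint_char_fun M X Y 0 t = char_fun M Y t"
  by (simp add: joint_char_fun_def char_fun_def)

lemma char_fun_minus: "char_fun M X (- t) = cnj (char_fun M X t)"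
  unfolding char_fun_def
  by (subst Bochner_Integration.integral_cnj[symmetric], rule Bochner_Integration.integral_cong) (simp_all add: exp_cnj)

lemma (in prob_space) char_fun_zero: "char_fun M X 0 = 1"
  by (simp add: char_fun_def prob_space)

text \<open>The common source of all three formulas: the one-vector cases arise by applying it to
  equal vectors.\<close>

lemma siCov_eq_moments:
  fixes X Y :: "'a \<Rightarrow> real ^ 'p" and Xs Ys :: "nat \<Rightarrow> 'b \<Rightarrow> real ^ 'p"
  assumes \<alpha>: "0 < \<alpha>" "\<alpha> < 2"
    and "prob_space M" and [measurable]: "X \<in> borel_measurable M" "Y \<in> borel_measurable M"
    and "prob_space N"
    and indep: "prob_space.indep_vars N (\<lambda>_. borel) (\<lambda>i \<omega>. (Xs i \<omega>, Ys i \<omega>)) {1..4}"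
    and distr_eq: "\<And>i. i \<in> {1..4} \<Longrightarrow>
          distr N borel (\<lambda>\<omega>. (Xs i \<omega>, Ys i \<omega>)) = distr M borel (\<lambda>\<omega>. (X \<omega>, Y \<omega>))"
    and mom: "integrable M (\<lambda>\<omega>. norm (X \<omega>) powr \<alpha>)" "integrable M (\<lambda>\<omega>. norm (Y \<omega>) powr \<alpha>)"
  shows "enn2ereal (siCov \<alpha> M X Y) = ereal (
        2 * (LINT \<omega>|N. norm (Xs 1 \<omega> + Ys 1 \<omega> - Xs 2 \<omega> - Ys 3 \<omega>) powr \<alpha>)
        - (LINT \<omega>|N. norm (Xs 1 \<omega> + Ys 2 \<omega> - Xs 3 \<omega> - Ys 4 \<omega>) powr \<alpha>)
        - (LINT \<omega>|N. norm (Xs 1 \<omega> + Ys 1 \<omega> - Xs 2 \<omega> - Ys 2 \<omega>) powr \<alpha>))"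
proof -
  interpret M: prob_space M by fact
  interpret N: prob_space N by fact
  have pair: "(\<lambda>\<omega>. (Xs i \<omega>, Ys i \<omega>)) \<in> borel_measurable N" if "i \<in> {1..4}" for i
    using indep that by (auto simp: N.indep_vars_def)
  have meas: "Xs i \<in> borel_measurable N" "Ys i \<in> borel_measurable N" if "i \<in> {1..4}" for i
    using measurable_compose[OF pair[OF that], of fst borel] measurable_compose[OF pair[OF that], of snd borel]
    by (auto simp: borel_prod[symmetric])
  \<comment> \<open>Moments depend only on the law, hence pass to the copies.\<close>
  have int: "integrable N (\<lambda>\<omega>. norm (Xs i \<omega>) powr \<alpha>)" "integrable N (\<lambda>\<omega>. norm (Ys i \<omega>) powr \<alpha>)"
    if i: "i \<in> {1..4}" for i
  proof -
    have [measurable]: "(\<lambda>p. norm (fst p) powr \<alpha>) \<in> borel_measurable (borel :: ((real ^ 'p) \<times> (real ^ 'p)) measure)"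
      "(\<lambda>p. norm (snd p) powr \<alpha>) \<in> borel_measurable (borel :: ((real ^ 'p) \<times> (real ^ 'p)) measure)"
      unfolding borel_prod[symmetric] by measurable
    have "integrable (distr M borel (\<lambda>\<omega>. (X \<omega>, Y \<omega>))) (\<lambda>p. norm (fst p) powr \<alpha>)"
      "integrable (distr M borel (\<lambda>\<omega>. (X \<omega>, Y \<omega>))) (\<lambda>p. norm (snd p) powr \<alpha>)"
      using mom by (auto simp: integrable_distr_eq)
    then show "integrable N (\<lambda>\<omega>. norm (Xs i \<omega>) powr \<alpha>)" "integrable N (\<lambda>\<omega>. norm (Ys i \<omega>) powr \<alpha>)"
      unfolding distr_eq[OF i, symmetric] using pair[OF i] by (auto simp: integrable_distr_eq)
  qed
  \<comment> \<open>\<open>a\<close> and \<open>b\<close> are the coefficients of the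
    \<open>Xs\<close> and \<open>Ys\<close>; \<open>f\<close> is the resulting characteristic
    function of \<open>Z\<close>. For a concrete choice the premises are finite
    computations.\<close>
  have comb: "has_bochner_integral lborel
       (\<lambda>t. (1 - Re (f t)) * rho \<alpha> t) (LINT \<omega>|N. norm (Z \<omega>) powr \<alpha>)"
    if f: "\<And>t. (\<Prod>i\<in>{1..4}. joint_char_fun M X Y (a i *\<^sub>R t) (b i *\<^sub>R t)) = f t"
      and Z: "\<And>\<omega>. (\<Sum>i\<in>{1..4}. a i *\<^sub>R Xs i \<omega> + b i *\<^sub>R Ys i \<omega>) = Z \<omega>"
    for f Z and a b :: "nat \<Rightarrow> real"
  proof -
    \<comment> \<open>Generalised to subsets of the indices so that the bound for two summands can
      be iterated.\<close>
    have *: "(\<lambda>\<omega>. \<Sum>i\<in>I. a i *\<^sub>R Xs i \<omega> + b i *\<^sub>R Ys i \<omega>) \<in> borel_measurable N \<and>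
        integrable N (\<lambda>\<omega>. norm (\<Sum>i\<in>I. a i *\<^sub>R Xs i \<omega> + b i *\<^sub>R Ys i \<omega>) powr \<alpha>)"
      if "finite I" "I \<subseteq> {1..4}" for I
      using that
    proof (induction I rule: finite_induct)
      case (insert i I)
      then have i: "i \<in> {1..4}" by auto
      note [measurable] = meas[OF i]
      from insert have IH [measurable]: "(\<lambda>\<omega>. \<Sum>i\<in>I. a i *\<^sub>R Xs i \<omega> + b i *\<^sub>R Ys i \<omega>) \<in> borel_measurable N"
        "integrable N (\<lambda>\<omega>. norm (\<Sum>i\<in>I. a i *\<^sub>R Xs i \<omega> + b i *\<^sub>R Ys i \<omega>) powr \<alpha>)" by auto
      have "integrable N (\<lambda>\<omega>. norm ((a i *\<^sub>R Xs i \<omega> + b i *\<^sub>R Ys i \<omega>) +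
         (\<Sum>i\<in>I. a i *\<^sub>R Xs i \<omega> + b i *\<^sub>R Ys i \<omega>)) powr \<alpha>)"
        using int[OF i] IH(2) \<alpha>
        by (intro integrable_norm_powr_add) (auto simp: powr_mult)
      with insert.hyps IH show ?case by simp
    qed simp
    have cf: "char_fun N (\<lambda>\<omega>. \<Sum>i\<in>{1..4}. a i *\<^sub>R Xs i \<omega> + b i *\<^sub>R Ys i \<omega>) t
      = (\<Prod>i\<in>{1..4}. joint_char_fun M X Y (a i *\<^sub>R t) (b i *\<^sub>R t))" for t
      by (rule N.char_fun_sum_indep_copies) (use indep distr_eq in auto)
    show ?thesis
      using N.has_bochner_integral_one_minus_Re_char_fun_rho[OF \<alpha>,
          of "\<lambda>\<omega>. \<Sum>i\<in>{1..4}. a i *\<^sub>R Xs i \<omega> + b i *\<^sub>R Ys i \<omega>"]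
        *[OF finite_atLeastAtMost subset_refl]
      unfolding cf unfolding f Z by blast
  qed
  have set4: "{1..4} = {1, 2, 3, 4 :: nat}" by auto
  let ?\<phi> = "\<lambda>t. joint_char_fun M X Y t t" and ?\<psi> = "\<lambda>t. char_fun M X t * char_fun M Y t"
  let ?A = "LINT \<omega>|N. norm (Xs 1 \<omega> + Ys 1 \<omega> - Xs 2 \<omega> - Ys 3 \<omega>) powr \<alpha>"
  let ?B = "LINT \<omega>|N. norm (Xs 1 \<omega> + Ys 2 \<omega> - Xs 3 \<omega> - Ys 4 \<omega>) powr \<alpha>"
  let ?C = "LINT \<omega>|N. norm (Xs 1 \<omega> + Ys 1 \<omega> - Xs 2 \<omega> - Ys 2 \<omega>) powr \<alpha>"
  note cf = joint_char_fun_minus joint_char_fun_zero_left joint_char_fun_zero_right char_fun_minus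
    M.char_fun_zero
  \<comment> \<open>Index 1 gives the joint function, indices 2 and 3 give conjugates of the two
    marginal ones, and index 4 gives 1.\<close>
  have A: "has_bochner_integral lborel (\<lambda>t. (1 - Re (?\<phi> t * cnj (?\<psi> t))) * rho \<alpha> t) ?A"
    by (rule comb[of "(\<lambda>_. 0)(1 := 1, 2 := -1)" "(\<lambda>_. 0)(1 := 1, 3 := -1)"])
      (simp_all only: set4, simp_all add: cf)
  \<comment> \<open>No index carries both an X and a Y, so all four factors are marginal.\<close>
  have B: "has_bochner_integral lborel (\<lambda>t. (1 - Re (?\<psi> t * cnj (?\<psi> t))) * rho \<alpha> t) ?B"
    by (rule comb[of "(\<lambda>_. 0)(1 := 1, 3 := -1)" "(\<lambda>_. 0)(2 := 1, 4 := -1)"])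
      (simp_all only: set4, simp_all add: cf)
  \<comment> \<open>X and Y always share their index, so both nontrivial factors are joint.\<close>
  have C: "has_bochner_integral lborel (\<lambda>t. (1 - Re (?\<phi> t * cnj (?\<phi> t))) * rho \<alpha> t) ?C"
    by (rule comb[of "(\<lambda>_. 0)(1 := 1, 2 := -1)" "(\<lambda>_. 0)(1 := 1, 2 := -1)"])
      (simp_all only: set4, simp_all add: cf)
  \<comment> \<open>In the combination 2 A - B - C the constants cancel, as 2 - 1 - 1 = 0, which
    leaves the expanded squared modulus.\<close>
  have "has_bochner_integral lborel (\<lambda>t. (cmod (?\<phi> t - ?\<psi> t))\<^sup>2 * rho \<alpha> t) (2 * ?A - ?B - ?C)"
    using has_bochner_integral_diff[OF has_bochner_integral_diff[OF has_bochner_integral_mult_right[OF A, of 2] B] C]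
    unfolding cmod_diff_squared by (rule has_bochner_integral_cong[THEN iffD1, rotated -1]) (auto simp: algebra_simps)
  \<comment> \<open>\<open>ennreal\<close> sends negative reals to 0, so recovering the real value
    requires nonnegativity.\<close>
  moreover from this have "2 * ?A - ?B - ?C \<ge> 0"
    using \<alpha> by (subst has_bochner_integral_integral_eq[symmetric]) (auto simp: rho_nonneg)
  ultimately have "siCov \<alpha> M X Y = ennreal (2 * ?A - ?B - ?C)" "2 * ?A - ?B - ?C \<ge> 0"
    unfolding siCov_def using \<alpha>
    by (simp_all add: has_bochner_integral_iff nn_integral_eq_integral rho_nonneg)
  then show ?thesis by (simp only: enn2ereal_ennreal)
qed

theorem theorem2p3:
  fixes \<alpha> :: real
    and M :: "'a measure" and X Y :: "'a \<Rightarrow> real ^ 'p"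
    and N :: "'b measure" and Xs Ys :: "nat \<Rightarrow> 'b \<Rightarrow> real ^ 'p"
  assumes "0 < \<alpha>" and "\<alpha> < 2"
    and "prob_space M" and "X \<in> borel_measurable M" and "Y \<in> borel_measurable M"
    and "prob_space N"
    and copies_indep: "prob_space.indep_vars N (\<lambda>_. borel) (\<lambda>i \<omega>. (Xs i \<omega>, Ys i \<omega>)) {1..4}"
    and copies_distr: "\<And>i. i \<in> {1..4} \<Longrightarrow>
          distr N borel (\<lambda>\<omega>. (Xs i \<omega>, Ys i \<omega>)) = distr M borel (\<lambda>\<omega>. (X \<omega>, Y \<omega>))"
    and moments: "(\<integral>\<^sup>+ \<omega>. ennreal (norm (X \<omega>) powr \<alpha>) \<partial>M) + (\<integral>\<^sup>+ \<omega>. ennreal (norm (Y \<omega>) powr \<alpha>) \<partial>M) < \<infinity>"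
  shows
    "enn2ereal (siCov \<alpha> M X Y) = ereal (
        2 * (LINT \<omega>|N. norm (Xs 1 \<omega> + Ys 1 \<omega> - Xs 2 \<omega> - Ys 3 \<omega>) powr \<alpha>)
        - (LINT \<omega>|N. norm (Xs 1 \<omega> + Ys 2 \<omega> - Xs 3 \<omega> - Ys 4 \<omega>) powr \<alpha>)
        - (LINT \<omega>|N. norm (Xs 1 \<omega> + Ys 1 \<omega> - Xs 2 \<omega> - Ys 2 \<omega>) powr \<alpha>)) \<and>
     enn2ereal (siCov \<alpha> M X X) = ereal (
        2 * (LINT \<omega>|N. norm (2 *\<^sub>R Xs 1 \<omega> - Xs 2 \<omega> - Xs 3 \<omega>) powr \<alpha>)
        - (LINT \<omega>|N. norm (Xs 1 \<omega> + Xs 2 \<omega> - Xs 3 \<omega> - Xs 4 \<omega>) powr \<alpha>)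
        - 2 powr \<alpha> * (LINT \<omega>|N. norm (Xs 1 \<omega> - Xs 2 \<omega>) powr \<alpha>)) \<and>
     enn2ereal (siCov \<alpha> M Y Y) = ereal (
        2 * (LINT \<omega>|N. norm (2 *\<^sub>R Ys 1 \<omega> - Ys 2 \<omega> - Ys 3 \<omega>) powr \<alpha>)
        - (LINT \<omega>|N. norm (Ys 1 \<omega> + Ys 2 \<omega> - Ys 3 \<omega> - Ys 4 \<omega>) powr \<alpha>)
        - 2 powr \<alpha> * (LINT \<omega>|N. norm (Ys 1 \<omega> - Ys 2 \<omega>) powr \<alpha>))"
proof -
  interpret M: prob_space M by fact
  interpret N: prob_space N by fact
  note [measurable] = \<open>X \<in> borel_measurable M\<close> \<open>Y \<in> borel_measurable M\<close>
  have int: "integrable M (\<lambda>\<omega>. norm (X \<omega>) powr \<alpha>)" "integrable M (\<lambda>\<omega>. norm (Y \<omega>) powr \<alpha>)"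
    using moments by (auto intro!: integrableI_nonneg simp: less_top)
  have pair: "(\<lambda>\<omega>. (Xs i \<omega>, Ys i \<omega>)) \<in> borel_measurable N" if "i \<in> {1..4}" for i
    using copies_indep that by (auto simp: N.indep_vars_def)
  \<comment> \<open>Doubling a function of each pair preserves independence and equality of laws;
    \<open>fst\<close> and \<open>snd\<close> give the pairs (X, X) and (Y, Y).\<close>
  have dup: "prob_space.indep_vars N (\<lambda>_. borel) (\<lambda>i \<omega>. (f (Xs i \<omega>, Ys i \<omega>), f (Xs i \<omega>, Ys i \<omega>))) {1..4}"
    "\<And>i. i \<in> {1..4} \<Longrightarrow> distr N borel (\<lambda>\<omega>. (f (Xs i \<omega>, Ys i \<omega>), f (Xs i \<omega>, Ys i \<omega>)))
        = distr M borel (\<lambda>\<omega>. (f (X \<omega>, Y \<omega>), f (X \<omega>, Y \<omega>)))"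
    if [measurable]: "f \<in> borel_measurable borel" for f :: "(real ^ 'p) \<times> (real ^ 'p) \<Rightarrow> real ^ 'p"
  proof -
    show "prob_space.indep_vars N (\<lambda>_. borel) (\<lambda>i \<omega>. (f (Xs i \<omega>, Ys i \<omega>), f (Xs i \<omega>, Ys i \<omega>))) {1..4}"
      by (rule N.indep_vars_compose2[OF copies_indep, where Y = "\<lambda>_ p. (f p, f p)"]) simp
    fix i :: nat assume i: "i \<in> {1..4}"
    have "distr N borel (\<lambda>\<omega>. (f (Xs i \<omega>, Ys i \<omega>), f (Xs i \<omega>, Ys i \<omega>)))
        = distr (distr N borel (\<lambda>\<omega>. (Xs i \<omega>, Ys i \<omega>))) borel (\<lambda>p. (f p, f p))"
      using pair[OF i] by (subst distr_distr) (auto simp: comp_def)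
    also have "\<dots> = distr M borel (\<lambda>\<omega>. (f (X \<omega>, Y \<omega>), f (X \<omega>, Y \<omega>)))"
      unfolding copies_distr[OF i] by (subst distr_distr) (auto simp: comp_def)
    finally show "distr N borel (\<lambda>\<omega>. (f (Xs i \<omega>, Ys i \<omega>), f (Xs i \<omega>, Ys i \<omega>)))
        = distr M borel (\<lambda>\<omega>. (f (X \<omega>, Y \<omega>), f (X \<omega>, Y \<omega>)))" .
  qed
  have [measurable]: "fst \<in> borel_measurable (borel :: ((real ^ 'p) \<times> (real ^ 'p)) measure)"
    "snd \<in> borel_measurable (borel :: ((real ^ 'p) \<times> (real ^ 'p)) measure)"
    unfolding borel_prod[symmetric] by measurable
  \<comment> \<open>For equal vectors the last combination is twice a difference, and homogeneity of
    the norm extracts \<open>2 powr \<alpha>\<close>.\<close>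
  have double: "enn2ereal (siCov \<alpha> M V V) = ereal (
        2 * (LINT \<omega>|N. norm (2 *\<^sub>R Vs 1 \<omega> - Vs 2 \<omega> - Vs 3 \<omega>) powr \<alpha>)
        - (LINT \<omega>|N. norm (Vs 1 \<omega> + Vs 2 \<omega> - Vs 3 \<omega> - Vs 4 \<omega>) powr \<alpha>)
        - 2 powr \<alpha> * (LINT \<omega>|N. norm (Vs 1 \<omega> - Vs 2 \<omega>) powr \<alpha>))"
    if [measurable]: "V \<in> borel_measurable M"
      and V: "integrable M (\<lambda>\<omega>. norm (V \<omega>) powr \<alpha>)"
      and Vs: "prob_space.indep_vars N (\<lambda>_. borel) (\<lambda>i \<omega>. (Vs i \<omega>, Vs i \<omega>)) {1..4}"
        "\<And>i. i \<in> {1..4} \<Longrightarrow> distr N borel (\<lambda>\<omega>. (Vs i \<omega>, Vs i \<omega>)) = distr M borel (\<lambda>\<omega>. (V \<omega>, V \<omega>))"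
    for V :: "'a \<Rightarrow> real ^ 'p" and Vs :: "nat \<Rightarrow> 'b \<Rightarrow> real ^ 'p"
  proof -
    have "Vs 1 \<omega> + Vs 1 \<omega> - Vs 2 \<omega> - Vs 2 \<omega> = 2 *\<^sub>R (Vs 1 \<omega> - Vs 2 \<omega>)" for \<omega>
      by (simp add: scaleR_2)
    then have "norm (Vs 1 \<omega> + Vs 1 \<omega> - Vs 2 \<omega> - Vs 2 \<omega>) powr \<alpha>
        = 2 powr \<alpha> * norm (Vs 1 \<omega> - Vs 2 \<omega>) powr \<alpha>" for \<omega>
      by (simp add: powr_mult)
    then show ?thesis
      using siCov_eq_moments[OF \<open>0 < \<alpha>\<close> \<open>\<alpha> < 2\<close> \<open>prob_space M\<close> that(1) that(1) \<open>prob_space N\<close> Vs V V]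
      by (simp only: scaleR_2 integral_mult_right_zero)
  qed
  show ?thesis
    using siCov_eq_moments[OF assms(1-8) int] double[OF _ int(1), of Xs] double[OF _ int(2), of Ys]
      dup[of fst] dup[of snd]
    by simp
qed

end
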